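(* Let $n$ be a positive integer, $0<\beta_1,\beta_2<1$, and let $\underline{V}=(V_1,V_2)$ be a random vector following the negative $\mathcal{R}(p,q)$-trinomial probability distribution of the second kind with parameters $n$, $\underline{\beta}=(\beta_1,\beta_2)$, $p$ and $q$, i.e. with mass function $$P(V_1=v_1,V_2=v_2)=\begin{bmatrix} n+v_1+v_2-1\\ v_1,v_2\end{bmatrix}_{\mathcal{R}(p,q)}\beta_1^{v_1}\beta_2^{v_2}\,(1\ominus\beta_1)^{n+v_2}_{\mathcal{R}(p,q)}\,(1\ominus\beta_2)^{n}_{\mathcal{R}(p,q)},\qquad v_1,v_2\in\mathbb{N}\cup\{0\}.$$ Then for all $m_1,m_2\in\mathbb{N}\cup\{0\}$ its $\mathcal{R}(p,q)$-factorial moments are given as follows. (1) $$E\big([V_2]_{m_2,\mathcal{R}(p,q)}\big)=\frac{\beta_2^{m_2}\,[n+m_2-1]_{m_2,\mathcal{R}(p,q)}}{\big(\phi_1^{n}\ominus\beta_2\,\phi_2^{n}\big)^{m_2}_{\mathcal{R}(p,q)}}.$$ (2) For $v_2\in\mathbb{N}\cup\{0\}$, $$E\big([V_1]_{m_1,\mathcal{R}(p,q)}\mid V_2=v_2\big)=\frac{\beta_1^{m_1}\,[n+v_2+m_1-1]_{m_1,\mathcal{R}(p,q)}}{\big(\phi_1^{n+v_2}\ominus\beta_1\,\phi_2^{n+v_2}\big)^{m_1}_{\mathcal{R}(p,q)}}.$$ (3) $$E\Big(\big(\phi_1^{n+V_2}\ominus\beta_1\,\phi_2^{n+V_2}\big)^{m_1}_{\mathcal{R}(p,q)}\,[V_1]_{m_1,\mathcal{R}(p,q)}\Big)=\frac{\beta_1^{m_1}\,[n+m_1-1]_{m_1,\mathcal{R}(p,q)}}{\big(\phi_1^{n}\ominus\beta_2\,\phi_2^{n}\big)^{m_1}_{\mathcal{R}(p,q)}}.$$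 (4) $$E\Big(\big(\phi_1^{n+V_2}\ominus\beta_1\,\phi_2^{n+V_2}\big)^{m_1}_{\mathcal{R}(p,q)}\,[V_1]_{m_1,\mathcal{R}(p,q)}\,[V_2]_{m_2,\mathcal{R}(p,q)}\Big)=\frac{\beta_1^{m_1}\beta_2^{m_2}\,[n+m_1+m_2-1]_{m_1+m_2,\mathcal{R}(p,q)}}{\big(\phi_1^{n}\ominus\beta_2\,\phi_2^{n}\big)^{m_1+m_2}_{\mathcal{R}(p,q)}}.$$
   Context: Let $0<q<p<1$ be real numbers and let $\mathcal{R}(u,v)=\sum_{s,t=-l}^{\infty}r_{st}u^sv^t$ ($r_{st}\in\mathbb{C}$, $l\in\mathbb{N}\cup\{0\}$) be a meromorphic function on $\mathbb{C}\times\mathbb{C}$ with $\mathcal{R}(p^n,q^n)>0$ for all $n\in\mathbb{N}$ and $\mathcal{R}(1,1)=0$. The $\mathcal{R}(p,q)$-deformed numbers are $[n]_{\mathcal{R}(p,q)}=\mathcal{R}(p^n,q^n)$, and it is assumed that they can be written as $[n]_{\mathcal{R}(p,q)}=\frac{\phi_1^n-\phi_2^n}{\phi_1-\phi_2}$, where $\phi_1\ne\phi_2$ are functions of the deformation parameters $p,q$. Factorials: $[0]!_{\mathcal{R}(p,q)}=1$ and $[n]!_{\mathcal{R}(p,q)}=\prod_{i=1}^{n}[i]_{\mathcal{R}(p,q)}$. Factorial of order $r$: $[u]_{r,\mathcal{R}(p,q)}=\prod_{i=1}^{r}[u-i+1]_{\mathcal{R}(p,q)}$, equal to $1$ for $r=0$.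 Trinomial coefficient: $\begin{bmatrix} N\\ a,b\end{bmatrix}_{\mathcal{R}(p,q)}=\frac{[N]!_{\mathcal{R}(p,q)}}{[a]!_{\mathcal{R}(p,q)}[b]!_{\mathcal{R}(p,q)}[N-a-b]!_{\mathcal{R}(p,q)}}$. Shifted factorial: $(u\ominus v)^n_{\mathcal{R}(p,q)}=\prod_{i=1}^{n}(u\phi_1^{i-1}-v\phi_2^{i-1})$, with $(u\ominus v)^0_{\mathcal{R}(p,q)}=1$. $E$ denotes expectation.
   Formalization: The formal theorem additionally assumes P(V_2=v_2)>0 for every v_2 in N∪{0}; without it the conditional expectation in (2) can be undefined and (1) fails for accidental parameters where a factor of the shifted factorial in β_1 vanishes, so that V_2 has bounded support. *)

theory Defs
  imports "HOL-Probability.Probability"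
begin

text \<open>Holomorphy in two complex variables (meant for open \<open>S\<close>): the Frechet derivative exists and
  is complex linear. The library covers only one complex variable.\<close>

definition holomorphic2_on :: "(complex \<times> complex \<Rightarrow> complex) \<Rightarrow> (complex \<times> complex) set \<Rightarrow> bool" where
  "holomorphic2_on f S \<longleftrightarrow>
     (\<forall>z\<in>S. \<exists>a b. (f has_derivative (\<lambda>(h, k). a * h + b * k)) (at z within S))"

definition holomorphic2_at :: "(complex \<times> complex \<Rightarrow> complex) \<Rightarrow> complex \<times> complex \<Rightarrow> bool" where
  "holomorphic2_at f z \<longleftrightarrow> (\<exists>U. open U \<and> z \<in> U \<and> holomorphic2_on f U)"

text \<open>Meromorphic on all of \<open>\<complex> \<times> \<complex>\<close>: locally a quotient of holomorphic functions. The total function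
  \<open>R\<close> is unconstrained where the denominator vanishes, so wherever a value of \<open>R\<close> is
  meant to be the value of the meromorphic function, \<open>holomorphic2_at\<close> has to be required.\<close>

definition meromorphic2 :: "(complex \<times> complex \<Rightarrow> complex) \<Rightarrow> bool" where
  "meromorphic2 R \<longleftrightarrow>
     (\<forall>z. \<exists>U f g. open U \<and> connected U \<and> z \<in> U \<and> holomorphic2_on f U \<and> holomorphic2_on g U \<and>
        (\<exists>w\<in>U. g w \<noteq> 0) \<and> (\<forall>w\<in>U. g w \<noteq> 0 \<longrightarrow> R w = f w / g w))"

text \<open>\<open>R(u,v) = \<Sum>\<^sub>s\<^sub>,\<^sub>t\<^sub>\<ge>\<^sub>-\<^sub>l r\<^sub>s\<^sub>t u\<^sup>s v\<^sup>t\<close>, as an absolutely convergent Laurent series at the origin. The radius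
  is left open, since a meromorphic function may have poles elsewhere.\<close>

definition has_laurent_series2 ::
    "(complex \<times> complex \<Rightarrow> complex) \<Rightarrow> nat \<Rightarrow> (int \<Rightarrow> int \<Rightarrow> complex) \<Rightarrow> bool" where
  "has_laurent_series2 R l r \<longleftrightarrow>
     (\<exists>\<rho>>0. \<forall>u v. 0 < norm u \<and> norm u < \<rho> \<and> 0 < norm v \<and> norm v < \<rho> \<longrightarrow>
        ((\<lambda>(s, t). r s t * u powi s * v powi t) has_sum R (u, v)) ({- int l..} \<times> {- int l..}))"

text \<open>\<open>Re\<close> only changes the type: the values \<open>R(p\<^sup>n, q\<^sup>n)\<close> are assumed to be real wherever this is used.\<close>

definition deformed_num :: "(complex \<times> complex \<Rightarrow> complex) \<Rightarrow> real \<Rightarrow> real \<Rightarrow> nat \<Rightarrow> real" where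
  "deformed_num R p q n = Re (R (of_real (p ^ n), of_real (q ^ n)))"

definition deformed_fact :: "(complex \<times> complex \<Rightarrow> complex) \<Rightarrow> real \<Rightarrow> real \<Rightarrow> nat \<Rightarrow> real" where
  "deformed_fact R p q n = (\<Prod>i=1..n. deformed_num R p q i)"

text \<open>Factorial \<open>[u]\<^sub>r\<close> of order \<open>r\<close>. Truncated subtraction is harmless: for \<open>r > u\<close> the product
  contains the factor \<open>[0] = R(1,1) = 0\<close>.\<close>

definition deformed_ffact :: "(complex \<times> complex \<Rightarrow> complex) \<Rightarrow> real \<Rightarrow> real \<Rightarrow> nat \<Rightarrow> nat \<Rightarrow> real" where
  "deformed_ffact R p q u r = (\<Prod>i=1..r. deformed_num R p q (u + 1 - i))"

definition deformed_trinomial ::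
    "(complex \<times> complex \<Rightarrow> complex) \<Rightarrow> real \<Rightarrow> real \<Rightarrow> nat \<Rightarrow> nat \<Rightarrow> nat \<Rightarrow> real" where
  "deformed_trinomial R p q N a b =
     deformed_fact R p q N / (deformed_fact R p q a * deformed_fact R p q b * deformed_fact R p q (N - a - b))"

text \<open>The shifted factorial \<open>(u \<ominus> v)\<^sup>n\<close>.\<close>

definition shifted_fact :: "real \<Rightarrow> real \<Rightarrow> real \<Rightarrow> real \<Rightarrow> nat \<Rightarrow> real" where
  "shifted_fact \<phi>1 \<phi>2 u v n = (\<Prod>i=1..n. u * \<phi>1 ^ (i - 1) - v * \<phi>2 ^ (i - 1))"

definition neg_trinomial2_mass ::
    "(complex \<times> complex \<Rightarrow> complex) \<Rightarrow> real \<Rightarrow> real \<Rightarrow> real \<Rightarrow> real \<Rightarrow> nat \<Rightarrow> real \<Rightarrow> real \<Rightarrow> nat \<Rightarrow> nat \<Rightarrow> real" where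
  "neg_trinomial2_mass R p q \<phi>1 \<phi>2 n \<beta>1 \<beta>2 v1 v2 =
     deformed_trinomial R p q (n + v1 + v2 - 1) v1 v2 * \<beta>1 ^ v1 * \<beta>2 ^ v2 *
     shifted_fact \<phi>1 \<phi>2 1 \<beta>1 (n + v2) * shifted_fact \<phi>1 \<phi>2 1 \<beta>2 n"

end

theory Submission
  imports Defs
begin

text \<open>
  For \<open>\<phi>1 = 1\<close> the deformed numbers are the classical \<open>q\<close>-numbers with base \<open>\<phi>2\<close> (below, \<open>q\<close> denotes
  this base and not the deformation parameter of the same name), and the
  four moments come from the \<open>q\<close>-binomial series
  \<open>\<Sum>v. gauss_coeff q k v * x ^ v = 1 / qpoch x q (Suc k)\<close>. A falling \<open>q\<close>-factorial cancels against
  the factorial in the denominator of the coefficient, so that a factorial moment is the same series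
  with \<open>k\<close> replaced by \<open>k + m\<close> and the summation index shifted by \<open>m\<close>
  (\<open>q_binomial_factorial_moment\<close>). The joint moment sums first over \<open>v1\<close>, where the extra factor
  \<open>qpoch (\<beta>1 * q ^ (n + v2)) q m1\<close> cancels the denominator that this sum produces, and then over \<open>v2\<close>
  (\<open>qmass_inner_sum\<close>, \<open>qmass_outer_sum\<close>). The first and third moments are the cases
  \<open>m1 = 0\<close> and \<open>m2 = 0\<close> of the joint one; the conditional moment is the inner sum divided by the mass of
  \<open>V2 = v2\<close>.

  The normalisation \<open>\<phi>1 = 1\<close> is a consequence of the mass function being a probability.
  Positivity of the law of \<open>V2\<close> forces \<open>\<beta>1 * \<phi>2 ^ j < \<phi>1 ^ j\<close> for all \<open>j \<ge> n\<close>, and together with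
  \<open>\<phi>1 + \<phi>2 = [2] > 0\<close> this gives \<open>\<bar>\<phi>2\<bar> < \<phi>1\<close> (\<open>dominant_root\<close>). Everything in the mass function is
  homogeneous in \<open>(\<phi>1, \<phi>2)\<close>, so with \<open>q = \<phi>2 / \<phi>1\<close> it equals the classical mass function of base
  \<open>q\<close> times \<open>\<phi>1 ^ e\<close>, where \<open>e\<close> is a nonnegative exponent depending on \<open>v1\<close> and \<open>v2\<close>
  (\<open>neg_trinomial2_mass_conv_qmass\<close>). Both mass functions have total mass \<open>1\<close>; a factor that lies on one side of \<open>1\<close>
  everywhere and differs from \<open>1\<close> at a point of positive mass would contradict this (\<open>tilt_eq_1\<close>).
\<close>

section \<open>Classical q-numbers\<close>

definition qnum :: "real \<Rightarrow> nat \<Rightarrow> real" where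
  "qnum q k = (1 - q ^ k) / (1 - q)"

definition qfact :: "real \<Rightarrow> nat \<Rightarrow> real" where
  "qfact q n = (\<Prod>i=1..n. qnum q i)"

definition qffact :: "real \<Rightarrow> nat \<Rightarrow> nat \<Rightarrow> real" where
  "qffact q u r = (\<Prod>i=1..r. qnum q (u + 1 - i))"

definition qpoch :: "real \<Rightarrow> real \<Rightarrow> nat \<Rightarrow> real" where
  "qpoch a q n = (\<Prod>i<n. 1 - a * q ^ i)"

text \<open>The Gaussian binomial coefficient with upper entry \<open>k + v\<close> and lower entry \<open>v\<close>. Indexing by the
  two lower parts avoids truncated subtraction.\<close>

definition gauss_coeff :: "real \<Rightarrow> nat \<Rightarrow> nat \<Rightarrow> real" where
  "gauss_coeff q k v = qfact q (k + v) / (qfact q k * qfact q v)"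

text \<open>The negative \<open>q\<close>-trinomial mass function of the second kind for \<open>n = Suc k\<close>, written as the
  conditional mass of \<open>V1 = v\<close> given \<open>V2 = w\<close> (first line) times the mass of \<open>V2 = w\<close> (second line).\<close>

definition qmass :: "real \<Rightarrow> nat \<Rightarrow> real \<Rightarrow> real \<Rightarrow> nat \<Rightarrow> nat \<Rightarrow> real" where
  "qmass q k a b v w =
     (qpoch a q (Suc (k + w)) * (gauss_coeff q (k + w) v * a ^ v)) *
     (qpoch b q (Suc k) * (gauss_coeff q k w * b ^ w))"

lemma qnum_0 [simp]: "qnum q 0 = 0"
  by (simp add: qnum_def)

lemma qnum_pos:
  assumes "\<bar>q\<bar> < 1" "k \<ge> 1"
  shows "qnum q k > 0"
proof -
  have "\<bar>q ^ k\<bar> < 1"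
    using assms by (simp add: power_abs power_less_one_iff)
  thus ?thesis using assms(1) by (simp add: qnum_def)
qed

lemma qnum_nonneg: "\<bar>q\<bar> < 1 \<Longrightarrow> qnum q k \<ge> 0"
  using qnum_pos[of q k] by (cases k) auto

lemma qfact_0 [simp]: "qfact q 0 = 1"
  by (simp add: qfact_def)

lemma qfact_Suc: "qfact q (Suc n) = qnum q (Suc n) * qfact q n"
  by (simp add: qfact_def)

lemma qfact_pos: "\<bar>q\<bar> < 1 \<Longrightarrow> qfact q n > 0"
  by (auto simp: qfact_def intro!: prod_pos qnum_pos)

lemma qffact_0 [simp]: "qffact q u 0 = 1"
  by (simp add: qffact_def)

lemma qffact_nonneg: "\<bar>q\<bar> < 1 \<Longrightarrow> qffact q u r \<ge> 0"
  by (auto simp: qffact_def intro!: prod_nonneg qnum_nonneg)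

lemma qffact_eq_0:
  assumes "u < r"
  shows "qffact q u r = 0"
proof -
  have "u + 1 \<in> {1..r}" "qnum q (u + 1 - (u + 1)) = 0" using assms by auto
  thus ?thesis unfolding qffact_def by (meson finite_atLeastAtMost prod_zero)
qed

lemma qffact_Suc_Suc: "qffact q (Suc u) (Suc r) = qnum q (Suc u) * qffact q u r"
proof -
  have "qffact q (Suc u) (Suc r) =
      qnum q (Suc u) * (\<Prod>i=Suc 1..Suc r. qnum q (Suc u + 1 - i))"
    by (simp add: qffact_def prod.atLeast_Suc_atMost)
  also have "(\<Prod>i=Suc 1..Suc r. qnum q (Suc u + 1 - i)) = qffact q u r"
    unfolding qffact_def by (subst prod.shift_bounds_cl_Suc_ivl) simp
  finally show ?thesis .
qed

lemma qffact_mult_qfact: "qffact q (u + r) r * qfact q u = qfact q (u + r)"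
  by (induction r) (simp_all add: qffact_Suc_Suc qfact_Suc mult.assoc)

lemma qpoch_0 [simp]: "qpoch a q 0 = 1"
  by (simp add: qpoch_def)

lemma qpoch_Suc: "qpoch a q (Suc n) = qpoch a q n * (1 - a * q ^ n)"
  by (simp add: qpoch_def)

lemma qpoch_add: "qpoch a q (n + m) = qpoch a q n * qpoch (a * q ^ n) q m"
  by (induction m) (simp_all add: qpoch_Suc power_add mult.assoc)

text \<open>The base may be negative, so the bound is on the absolute value; it keeps all factors of the
  shifted factorials positive and the geometric series below convergent.\<close>

lemma abs_mult_power_less_1:
  fixes a q :: real
  assumes "\<bar>q\<bar> < 1" "0 < a" "a < 1"
  shows "\<bar>a * q ^ n\<bar> < 1"
proof -
  have "\<bar>q\<bar> ^ n \<le> 1" using assms(1) by (simp add: power_le_one)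
  hence "a * \<bar>q\<bar> ^ n \<le> a" using assms by (simp add: mult_left_le)
  hence "a * \<bar>q\<bar> ^ n < 1" using assms by linarith
  thus ?thesis using assms by (simp add: abs_mult power_abs)
qed

lemma qpoch_pos:
  assumes "\<bar>q\<bar> < 1" "0 < a" "a < 1"
  shows "qpoch a q n > 0" "qpoch (a * q ^ j) q n > 0"
proof -
  have *: "a * q ^ i < 1" for i
    using abs_mult_power_less_1[OF assms, of i] by linarith
  show "qpoch a q n > 0"
    using * by (auto simp: qpoch_def intro!: prod_pos)
  show "qpoch (a * q ^ j) q n > 0"
    using * by (auto simp: qpoch_def mult.assoc simp flip: power_add intro!: prod_pos)
qed

section \<open>The q-binomial series and its factorial moments\<close>

lemma gauss_coeff_pos: "\<bar>q\<bar> < 1 \<Longrightarrow> gauss_coeff q k v > 0"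
  by (simp add: gauss_coeff_def qfact_pos)

lemma gauss_coeff_0_right [simp]: "\<bar>q\<bar> < 1 \<Longrightarrow> gauss_coeff q k 0 = 1"
  using qfact_pos[of q k] by (simp add: gauss_coeff_def)

lemma gauss_coeff_0_left [simp]: "\<bar>q\<bar> < 1 \<Longrightarrow> gauss_coeff q 0 v = 1"
  using qfact_pos[of q v] by (simp add: gauss_coeff_def)

lemma qnum_add: "q \<noteq> 1 \<Longrightarrow> qnum q (m + n) = qnum q m + q ^ m * qnum q n"
  by (simp add: qnum_def field_simps power_add)

text \<open>The \<open>q\<close>-Pascal rule: split \<open>[k + 1 + v + 1] = [k + 1] + q ^ (k + 1) * [v + 1]\<close> in the numerator.\<close>

lemma gauss_coeff_Suc_Suc:
  assumes "\<bar>q\<bar> < 1"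
  shows "gauss_coeff q (Suc k) (Suc v) =
           gauss_coeff q k (Suc v) + q ^ Suc k * gauss_coeff q (Suc k) v"
proof -
  have pos: "qfact q k > 0" "qfact q v > 0" "qnum q (Suc k) > 0" "qnum q (Suc v) > 0"
    using assms by (simp_all add: qfact_pos qnum_pos)
  have "qnum q (Suc k + Suc v) = qnum q (Suc k) + q ^ Suc k * qnum q (Suc v)"
    using assms by (intro qnum_add) auto
  hence "qfact q (Suc k + Suc v) =
      (qnum q (Suc k) + q ^ Suc k * qnum q (Suc v)) * qfact q (Suc (k + v))"
    by (simp add: qfact_Suc)
  thus ?thesis
    using pos by (simp add: gauss_coeff_def qfact_Suc[of q k] qfact_Suc[of q v] field_simps)
qed

text \<open>Unrolling the Pascal rule in \<open>v\<close> exhibits the coefficients for \<open>Suc k\<close> as the convolution of those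
  for \<open>k\<close> with the powers of \<open>q ^ Suc k\<close>.\<close>

lemma gauss_coeff_Suc_conv_sum:
  assumes "\<bar>q\<bar> < 1"
  shows "gauss_coeff q (Suc k) v = (\<Sum>j\<le>v. gauss_coeff q k j * (q ^ Suc k) ^ (v - j))"
proof (induction v)
  case 0
  show ?case using assms by simp
next
  case (Suc v)
  have "(\<Sum>j\<le>v. gauss_coeff q k j * (q ^ Suc k) ^ (Suc v - j)) =
      q ^ Suc k * (\<Sum>j\<le>v. gauss_coeff q k j * (q ^ Suc k) ^ (v - j))"
    unfolding sum_distrib_left by (intro sum.cong) (auto simp: Suc_diff_le)
  thus ?case using Suc.IH assms by (simp add: gauss_coeff_Suc_Suc)
qed

text \<open>By the convolution formula the series for \<open>Suc k\<close> is the Cauchy product of the series for \<open>k\<close>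
  with the geometric series in \<open>x * q ^ Suc k\<close>, so each step contributes one factor
  \<open>1 / (1 - x * q ^ Suc k)\<close>, and convergence is obtained along with the value. The coefficients are
  positive, so for \<open>x > 0\<close> convergence is absolute.\<close>

lemma q_binomial_series:
  assumes "\<bar>q\<bar> < 1" "0 < x" "x < 1"
  shows "(\<lambda>v. gauss_coeff q k v * x ^ v) sums (1 / qpoch x q (Suc k))"
proof (induction k)
  case 0
  show ?case using assms geometric_sums[of x] by (simp add: qpoch_Suc)
next
  case (Suc k)
  have y: "\<bar>x * q ^ Suc k\<bar> < 1" by (rule abs_mult_power_less_1[OF assms])
  have geo: "(\<lambda>i. (x * q ^ Suc k) ^ i) sums (1 / (1 - x * q ^ Suc k))"
    using geometric_sums[of "x * q ^ Suc k"] y by simp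
  have "summable (\<lambda>i. norm ((x * q ^ Suc k) ^ i))"
    using y by (simp add: power_abs summable_geometric)
  moreover have "norm (gauss_coeff q k v * x ^ v) = gauss_coeff q k v * x ^ v" for v
    using assms gauss_coeff_pos[of q k v] by simp
  hence "summable (\<lambda>v. norm (gauss_coeff q k v * x ^ v))"
    using Suc.IH by (simp add: sums_iff)
  ultimately have "(\<lambda>v. \<Sum>j\<le>v. (gauss_coeff q k j * x ^ j) * (x * q ^ Suc k) ^ (v - j)) sums
      ((\<Sum>v. gauss_coeff q k v * x ^ v) * (\<Sum>i. (x * q ^ Suc k) ^ i))"
    by (intro Cauchy_product_sums)
  moreover have "(\<Sum>j\<le>v. (gauss_coeff q k j * x ^ j) * (x * q ^ Suc k) ^ (v - j)) =
      gauss_coeff q (Suc k) v * x ^ v" for v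
    unfolding gauss_coeff_Suc_conv_sum[OF assms(1)] sum_distrib_right
  proof (intro sum.cong refl)
    fix j assume "j \<in> {..v}"
    hence "x ^ v = x ^ j * x ^ (v - j)" by (simp flip: power_add)
    thus "gauss_coeff q k j * x ^ j * (x * q ^ Suc k) ^ (v - j) =
        gauss_coeff q k j * (q ^ Suc k) ^ (v - j) * x ^ v"
      by (simp only: power_mult_distrib) (simp only: mult_ac)
  qed
  moreover have "(\<Sum>v. gauss_coeff q k v * x ^ v) * (\<Sum>i. (x * q ^ Suc k) ^ i) =
      1 / qpoch x q (Suc (Suc k))"
    using Suc.IH geo by (simp add: sums_iff qpoch_Suc)
  ultimately show ?case by simp
qed

text \<open>Both sides are \<open>[k + v + m]! / ([k]! * [v]!)\<close>: the falling factorial turns \<open>[v + m]!\<close> in the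
  denominator into \<open>[v]!\<close>, and the right-hand side collects the result as a coefficient again.\<close>

lemma gauss_coeff_shift:
  assumes "\<bar>q\<bar> < 1"
  shows "qffact q (v + m) m * gauss_coeff q k (v + m) = qffact q (k + m) m * gauss_coeff q (k + m) v"
proof -
  have "qfact q v > 0" "qfact q k > 0" "qfact q (k + m) > 0" "qfact q (v + m) > 0"
    using assms by (simp_all add: qfact_pos)
  thus ?thesis
    using qffact_mult_qfact[of q v m] qffact_mult_qfact[of q k m]
    by (simp add: gauss_coeff_def field_simps)
      (metis (no_types, lifting) ab_semigroup_add_class.add_ac(1) add.commute mult.assoc mult.commute)
qed

text \<open>The companion identity, where the falling factorial extends the numerator \<open>[k + v]!\<close> to
  \<open>[k + v + m]!\<close>. It absorbs what the summation over \<open>v1\<close> leaves behind into the coefficient of the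
  summation over \<open>v2\<close>.\<close>

lemma gauss_coeff_qffact:
  assumes "\<bar>q\<bar> < 1"
  shows "qffact q (k + v + m) m * gauss_coeff q k v = qffact q (k + m) m * gauss_coeff q (k + m) v"
proof -
  have "qfact q v > 0" "qfact q k > 0" "qfact q (k + m) > 0"
    using assms by (simp_all add: qfact_pos)
  thus ?thesis
    using qffact_mult_qfact[of q "k + v" m] qffact_mult_qfact[of q k m]
    by (simp add: gauss_coeff_def field_simps)
qed

text \<open>The terms with \<open>v < m\<close> vanish, because the falling factorial then contains \<open>[0]\<close>; after the
  shift by \<open>m\<close> what remains is the \<open>q\<close>-binomial series with \<open>k + m\<close> in place of \<open>k\<close>.\<close>

lemma q_binomial_factorial_moment:
  assumes "\<bar>q\<bar> < 1" "0 < x" "x < 1"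
  shows "(\<lambda>v. qffact q v m * (gauss_coeff q k v * x ^ v)) sums
           (x ^ m * qffact q (k + m) m / qpoch x q (Suc k + m))"
proof -
  have "qffact q (v + m) m * (gauss_coeff q k (v + m) * x ^ (v + m)) =
      x ^ m * qffact q (k + m) m * (gauss_coeff q (k + m) v * x ^ v)" for v
    using gauss_coeff_shift[OF assms(1), of v m k] by (simp add: power_add) 
  moreover have "(\<lambda>v. x ^ m * qffact q (k + m) m * (gauss_coeff q (k + m) v * x ^ v)) sums
      (x ^ m * qffact q (k + m) m * (1 / qpoch x q (Suc (k + m))))"
    by (intro sums_mult q_binomial_series assms)
  ultimately have "(\<lambda>v. qffact q (v + m) m * (gauss_coeff q k (v + m) * x ^ (v + m))) sums
      (x ^ m * qffact q (k + m) m / qpoch x q (Suc k + m))"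
    by simp
  thus ?thesis
    by (subst (asm) sums_zero_iff_shift) (simp_all add: qffact_eq_0)
qed

section \<open>Moment sums of the classical negative q-trinomial distribution\<close>

lemma qmass_pos:
  assumes "\<bar>q\<bar> < 1" "0 < a" "a < 1" "0 < b" "b < 1"
  shows "qmass q k a b v w > 0"
  using assms by (simp add: qmass_def qpoch_pos gauss_coeff_pos)

lemma qmass_inner_sum:
  assumes "\<bar>q\<bar> < 1" "0 < a" "a < 1"
  shows "(\<lambda>v. qffact q v m * qmass q k a b v w) sums
           (a ^ m * qffact q (k + w + m) m / qpoch (a * q ^ Suc (k + w)) q m *
            (qpoch b q (Suc k) * (gauss_coeff q k w * b ^ w)))"
proof -
  define B where "B = qpoch b q (Suc k) * (gauss_coeff q k w * b ^ w)"
  define A where "A = qpoch a q (Suc (k + w))"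
  have A: "A > 0" unfolding A_def by (rule qpoch_pos(1)[OF assms])
  have "(\<lambda>v. A * (qffact q v m * (gauss_coeff q (k + w) v * a ^ v)) * B) sums
      (A * (a ^ m * qffact q (k + w + m) m / qpoch a q (Suc (k + w) + m)) * B)"
    by (intro sums_mult sums_mult2 q_binomial_factorial_moment assms)
  moreover have "A * (qffact q v m * (gauss_coeff q (k + w) v * a ^ v)) * B =
      qffact q v m * qmass q k a b v w" for v
    by (simp add: qmass_def A_def B_def)
  moreover have "qpoch a q (Suc (k + w) + m) = A * qpoch (a * q ^ Suc (k + w)) q m"
    unfolding A_def by (rule qpoch_add)
  hence "A * (a ^ m * qffact q (k + w + m) m / qpoch a q (Suc (k + w) + m)) * B =
      a ^ m * qffact q (k + w + m) m / qpoch (a * q ^ Suc (k + w)) q m * B"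
    using A by simp
  ultimately show ?thesis
    by (simp only: B_def)
qed

text \<open>The factor \<open>qffact q (k + w + m1) m1\<close> is what the inner sum contributes once its power of \<open>a\<close> is
  pulled out and its denominator is cancelled by the weight in the joint moment. Absorbing it into the coefficient replaces \<open>k\<close> by \<open>k + m1\<close>, so the
  sum over \<open>w\<close> is again a univariate factorial moment.\<close>

lemma qmass_outer_sum:
  assumes "\<bar>q\<bar> < 1" "0 < b" "b < 1"
  shows "(\<lambda>w. qffact q w m2 * (qffact q (k + w + m1) m1 *
              (qpoch b q (Suc k) * (gauss_coeff q k w * b ^ w)))) sums
           (b ^ m2 * qffact q (k + m1 + m2) (m1 + m2) / qpoch (b * q ^ Suc k) q (m1 + m2))"
proof -
  define B where "B = qpoch b q (Suc k)"
  have B: "B > 0" unfolding B_def by (rule qpoch_pos(1)[OF assms])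
  have "(\<lambda>w. B * qffact q (k + m1) m1 * (qffact q w m2 * (gauss_coeff q (k + m1) w * b ^ w))) sums
      (B * qffact q (k + m1) m1 *
       (b ^ m2 * qffact q (k + m1 + m2) m2 / qpoch b q (Suc (k + m1) + m2)))"
    by (intro sums_mult q_binomial_factorial_moment assms)
  moreover have "B * qffact q (k + m1) m1 * (qffact q w m2 * (gauss_coeff q (k + m1) w * b ^ w)) =
      qffact q w m2 * (qffact q (k + w + m1) m1 * (B * (gauss_coeff q k w * b ^ w)))" for w
    using gauss_coeff_qffact[OF assms(1), of k w m1] by (simp add: mult_ac)
  moreover have "qffact q (k + m1) m1 * qffact q (k + m1 + m2) m2 = qffact q (k + m1 + m2) (m1 + m2)"
  proof -
    have "qffact q (k + m1) m1 * qffact q (k + m1 + m2) m2 * qfact q k =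
        qffact q (k + m1 + m2) (m1 + m2) * qfact q k"
      using qffact_mult_qfact[of q k m1] qffact_mult_qfact[of q "k + m1" m2]
        qffact_mult_qfact[of q k "m1 + m2"] by (metis add.assoc mult.assoc mult.commute)
    thus ?thesis using qfact_pos[OF assms(1), of k] by simp
  qed
  moreover have "qpoch b q (Suc (k + m1) + m2) = B * qpoch (b * q ^ Suc k) q (m1 + m2)"
    unfolding B_def by (subst qpoch_add[symmetric]) (simp add: add_ac)
  hence "B * qffact q (k + m1) m1 *
        (b ^ m2 * qffact q (k + m1 + m2) m2 / qpoch b q (Suc (k + m1) + m2)) =
      b ^ m2 * (qffact q (k + m1) m1 * qffact q (k + m1 + m2) m2) / qpoch (b * q ^ Suc k) q (m1 + m2)"
    using B by simp
  ultimately show ?thesis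
    by (simp only: B_def)
qed

lemma qmass_total:
  assumes "\<bar>q\<bar> < 1" "0 < a" "a < 1" "0 < b" "b < 1"
  shows "(\<lambda>v. qmass q k a b v w) sums (qpoch b q (Suc k) * (gauss_coeff q k w * b ^ w))"
    and "(\<lambda>w. qpoch b q (Suc k) * (gauss_coeff q k w * b ^ w)) sums 1"
  using qmass_inner_sum[of q a 0 k b w] qmass_outer_sum[of q b 0 k 0] assms by simp_all

section \<open>Expectations of functions of a pair of discrete variables\<close>

text \<open>For a nonnegative function integrability follows from convergence of the iterated sum: the
  integrand is a countable sum of indicator functions of the level sets, which can be integrated term by
  term in the extended nonnegative reals.\<close>

lemma has_bochner_integral_nat_pair:
  fixes F :: "nat \<Rightarrow> nat \<Rightarrow> real"
  assumes "prob_space M"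
    and V1: "V1 \<in> measurable M (count_space UNIV)"
    and V2: "V2 \<in> measurable M (count_space UNIV)"
    and nonneg: "\<And>v w. F v w \<ge> 0"
    and inner: "\<And>w. (\<lambda>v. F v w * measure M {\<omega> \<in> space M. V1 \<omega> = v \<and> V2 \<omega> = w}) sums a w"
    and outer: "a sums x"
  shows "has_bochner_integral M (\<lambda>\<omega>. F (V1 \<omega>) (V2 \<omega>)) x"
proof -
  interpret prob_space M by fact
  note [measurable] = V1 V2
  define A where "A v w = {\<omega> \<in> space M. V1 \<omega> = v \<and> V2 \<omega> = w}" for v w
  have A [measurable]: "A v w \<in> sets M" for v w
    unfolding A_def by measurable
  have a_nonneg: "a w \<ge> 0" for w
    using nonneg by (intro sums_le[OF _ sums_zero inner[of w]]) auto
  have x_nonneg: "x \<ge> 0"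
    using a_nonneg by (intro sums_le[OF _ sums_zero outer]) auto
  have split: "ennreal (F (V1 \<omega>) (V2 \<omega>)) =
      (\<Sum>w. \<Sum>v. ennreal (F v w) * indicator (A v w) \<omega>)" if "\<omega> \<in> space M" for \<omega>
  proof -
    have "(\<lambda>v. ennreal (F v w) * indicator (A v w) \<omega>) =
        (\<lambda>v. if v = V1 \<omega> then if w = V2 \<omega> then ennreal (F v w) else 0 else 0)" for w
      using that by (auto simp: A_def indicator_def)
    moreover have "(\<lambda>v. if v = V1 \<omega> then if w = V2 \<omega> then ennreal (F v w) else 0 else 0) sums
        (if w = V2 \<omega> then ennreal (F (V1 \<omega>) w) else 0)" for w
      by (rule sums_single)
    ultimately have "(\<Sum>v. ennreal (F v w) * indicator (A v w) \<omega>) =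
        (if w = V2 \<omega> then ennreal (F (V1 \<omega>) w) else 0)" for w
      by (simp add: sums_iff)
    moreover have "(\<lambda>w. if w = V2 \<omega> then ennreal (F (V1 \<omega>) w) else 0) sums
        ennreal (F (V1 \<omega>) (V2 \<omega>))"
      by (rule sums_single)
    ultimately show ?thesis by (simp add: sums_iff)
  qed
  have "(\<integral>\<^sup>+\<omega>. ennreal (F (V1 \<omega>) (V2 \<omega>)) \<partial>M) =
      (\<integral>\<^sup>+\<omega>. (\<Sum>w. \<Sum>v. ennreal (F v w) * indicator (A v w) \<omega>) \<partial>M)"
    by (intro nn_integral_cong split)
  also have "\<dots> = (\<Sum>w. \<Sum>v. ennreal (F v w) * emeasure M (A v w))"
    by (simp add: nn_integral_suminf nn_integral_cmult)
  also have "\<dots> = (\<Sum>w. \<Sum>v. ennreal (F v w * measure M (A v w)))"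
    using nonneg by (simp add: emeasure_eq_measure ennreal_mult)
  also have "\<dots> = (\<Sum>w. ennreal (a w))"
    using nonneg inner by (intro suminf_cong suminf_ennreal_eq) (auto simp: A_def)
  also have "\<dots> = ennreal x"
    by (rule suminf_ennreal_eq[OF a_nonneg outer])
  finally show ?thesis
    using nonneg x_nonneg by (intro has_bochner_integral_nn_integral) auto
qed

lemma sums_measure_level_sets:
  assumes "prob_space M"
    and V1: "V1 \<in> measurable M (count_space (UNIV :: nat set))"
    and V2: "V2 \<in> measurable M (count_space (UNIV :: nat set))"
  shows "(\<lambda>v. measure M {\<omega> \<in> space M. V1 \<omega> = v \<and> V2 \<omega> = w}) sums
           measure M {\<omega> \<in> space M. V2 \<omega> = w}"
proof -
  interpret prob_space M by fact
  note [measurable] = V1 V2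
  have "(\<lambda>v. measure M {\<omega> \<in> space M. V1 \<omega> = v \<and> V2 \<omega> = w}) sums
      measure M (\<Union>v. {\<omega> \<in> space M. V1 \<omega> = v \<and> V2 \<omega> = w})"
    by (intro finite_measure_UNION) (auto simp: disjoint_family_on_def)
  also have "(\<Union>v. {\<omega> \<in> space M. V1 \<omega> = v \<and> V2 \<omega> = w}) = {\<omega> \<in> space M. V2 \<omega> = w}"
    by auto
  finally show ?thesis .
qed

text \<open>Under the conditional measure the pair has mass only in the row \<open>V2 = w\<close>, so the outer sum of the
  pair formula collapses to a single term.\<close>

lemma conditional_moment_of_mass:
  fixes V1 V2 :: "'a \<Rightarrow> nat" and f :: "nat \<Rightarrow> real"
  assumes "prob_space M"
    and V1: "V1 \<in> measurable M (count_space UNIV)"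
    and V2: "V2 \<in> measurable M (count_space UNIV)"
    and nonneg: "\<And>v. f v \<ge> 0"
    and pos: "measure M {\<omega> \<in> space M. V2 \<omega> = w} > 0"
    and s: "(\<lambda>v. f v * measure M {\<omega> \<in> space M. V1 \<omega> = v \<and> V2 \<omega> = w}) sums
              (x * measure M {\<omega> \<in> space M. V2 \<omega> = w})"
  shows "has_bochner_integral (uniform_measure M {\<omega> \<in> space M. V2 \<omega> = w}) (\<lambda>\<omega>. f (V1 \<omega>)) x"
proof -
  interpret prob_space M by fact
  note [measurable] = V1 V2
  define B where "B = {\<omega> \<in> space M. V2 \<omega> = w}"
  have pB: "measure M B > 0" using pos by (simp add: B_def)
  hence em: "emeasure M B \<noteq> 0" by (simp add: emeasure_eq_measure)
  have mu: "measure (uniform_measure M B) {\<omega> \<in> space (uniform_measure M B). V1 \<omega> = v \<and> V2 \<omega> = w'} =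
      (if w' = w then measure M {\<omega> \<in> space M. V1 \<omega> = v \<and> V2 \<omega> = w} / measure M B else 0)" for v w'
  proof -
    have "{\<omega> \<in> space M. V1 \<omega> = v \<and> V2 \<omega> = w'} \<in> sets M" by measurable
    hence "measure (uniform_measure M B) {\<omega> \<in> space M. V1 \<omega> = v \<and> V2 \<omega> = w'} =
        measure M (B \<inter> {\<omega> \<in> space M. V1 \<omega> = v \<and> V2 \<omega> = w'}) / measure M B"
      using em by (intro measure_uniform_measure) auto
    also have "B \<inter> {\<omega> \<in> space M. V1 \<omega> = v \<and> V2 \<omega> = w'} =
        (if w' = w then {\<omega> \<in> space M. V1 \<omega> = v \<and> V2 \<omega> = w} else {})"
      by (auto simp: B_def)
    finally show ?thesis by auto
  qed
  have "has_bochner_integral (uniform_measure M B) (\<lambda>\<omega>. (\<lambda>v _. f v) (V1 \<omega>) (V2 \<omega>)) x"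
  proof (rule has_bochner_integral_nat_pair[where F = "\<lambda>v _. f v" and ?V1.0 = V1 and ?V2.0 = V2
        and a = "\<lambda>w'. if w' = w then x else 0"])
    show "prob_space (uniform_measure M B)"
      using em by (intro prob_space_uniform_measure) auto
    show "V1 \<in> measurable (uniform_measure M B) (count_space UNIV)" by measurable
    show "V2 \<in> measurable (uniform_measure M B) (count_space UNIV)" by measurable
    show "f v \<ge> 0" for v by (rule nonneg)
    show "(\<lambda>w'. if w' = w then x else 0) sums x"
      using sums_single[of w "\<lambda>_. x"] by simp
    show "(\<lambda>v. f v * measure (uniform_measure M B)
              {\<omega> \<in> space (uniform_measure M B). V1 \<omega> = v \<and> V2 \<omega> = w'}) sums
          (if w' = w then x else 0)" for w'
      using sums_divide[OF s, of "measure M B"] pB unfolding mu by (auto simp: B_def)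
  qed
  thus ?thesis by (simp add: B_def)
qed

section \<open>Rigidity of the deformation parameters\<close>

text \<open>If \<open>\<phi>1\<close> were not strictly dominant, then \<open>\<bar>\<phi>1\<bar> < \<phi>2\<close>, since the sum is positive, and \<open>(\<phi>1 / \<phi>2) ^ j\<close> would tend to \<open>0\<close>,
  hence drop below \<open>\<beta>\<close>.\<close>

lemma dominant_root:
  fixes \<phi>1 \<phi>2 \<beta> :: real
  assumes sum: "\<phi>1 + \<phi>2 > 0" and "\<phi>1 \<noteq> \<phi>2" "\<beta> > 0"
    and ev: "\<And>j. j \<ge> n \<Longrightarrow> \<beta> * \<phi>2 ^ j < \<phi>1 ^ j"
  shows "\<bar>\<phi>2\<bar> < \<phi>1"
proof (rule ccontr)
  assume "\<not> \<bar>\<phi>2\<bar> < \<phi>1"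
  hence lt: "\<phi>2 > 0" "\<bar>\<phi>1\<bar> < \<phi>2" using sum \<open>\<phi>1 \<noteq> \<phi>2\<close> by linarith+
  hence "(\<lambda>j. (\<phi>1 / \<phi>2) ^ j) \<longlonglongrightarrow> 0"
    by (intro LIMSEQ_power_zero) (simp add: abs_div)
  hence "\<forall>\<^sub>F j in sequentially. (\<phi>1 / \<phi>2) ^ j < \<beta>"
    using \<open>\<beta> > 0\<close> by (rule order_tendstoD(2))
  moreover have "\<forall>\<^sub>F j in sequentially. j \<ge> n" by (rule eventually_ge_at_top)
  ultimately obtain j where j: "(\<phi>1 / \<phi>2) ^ j < \<beta>" "j \<ge> n"
    using eventually_happens'[OF sequentially_bot eventually_conj] by blast
  hence "\<phi>1 ^ j < \<beta> * \<phi>2 ^ j"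
    using lt(1) by (simp add: power_divide field_simps)
  with ev[OF j(2)] show False by simp
qed

text \<open>The degree of homogeneity in \<open>(\<phi>1, \<phi>2)\<close> of the mass at \<open>(v, w)\<close> for \<open>n = Suc k\<close>. The deformed
  factorial of \<open>j\<close> and the shifted factorial of order \<open>j\<close> both have degree \<open>j choose 2\<close>; the first two
  summands are the degree of the trinomial coefficient, the last two come from the shifted factorials.\<close>

definition tilt_exponent :: "nat \<Rightarrow> nat \<Rightarrow> nat \<Rightarrow> nat" where
  "tilt_exponent k v w = k * v + (k + v) * w + (Suc (k + w) choose 2) + (Suc k choose 2)"

lemma Suc_choose_two: "Suc n choose 2 = n + (n choose 2)"
  by (simp add: numeral_2_eq_2)

lemma add_choose_two: "(a + b) choose 2 = (a choose 2) + (b choose 2) + a * b"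
  by (induction b) (simp_all add: Suc_choose_two numeral_2_eq_2[symmetric])

text \<open>Powers of \<open>\<phi>1\<close> are extracted from each ingredient of the mass function, leaving its classical
  counterpart of base \<open>\<phi>2 / \<phi>1\<close>.\<close>

context
  fixes R :: "complex \<times> complex \<Rightarrow> complex" and p q \<phi>1 \<phi>2 :: real
  assumes num: "\<And>j. deformed_num R p q j = (\<phi>1 ^ j - \<phi>2 ^ j) / (\<phi>1 - \<phi>2)"
    and \<phi>1: "\<phi>1 \<noteq> 0" "\<phi>1 \<noteq> \<phi>2"
begin

lemma deformed_num_Suc: "deformed_num R p q (Suc j) = \<phi>1 ^ j * qnum (\<phi>2 / \<phi>1) (Suc j)"
proof -
  have "\<phi>1 - \<phi>2 \<noteq> 0" using \<phi>1 by simp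
  thus ?thesis using \<phi>1 by (simp add: num qnum_def field_simps)
qed

lemma deformed_fact_conv_qfact:
  "deformed_fact R p q j = \<phi>1 ^ (j choose 2) * qfact (\<phi>2 / \<phi>1) j"
proof (induction j)
  case 0
  show ?case by (simp add: deformed_fact_def binomial_eq_0)
next
  case (Suc j)
  have "deformed_fact R p q (Suc j) = deformed_num R p q (Suc j) * deformed_fact R p q j"
    by (simp add: deformed_fact_def)
  thus ?case using Suc.IH by (simp add: deformed_num_Suc qfact_Suc Suc_choose_two power_add)
qed

lemma shifted_fact_conv_qpoch:
  "shifted_fact \<phi>1 \<phi>2 1 \<beta> j = \<phi>1 ^ (j choose 2) * qpoch \<beta> (\<phi>2 / \<phi>1) j"
proof (induction j)
  case 0
  show ?case by (simp add: shifted_fact_def binomial_eq_0)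
next
  case (Suc j)
  have "shifted_fact \<phi>1 \<phi>2 1 \<beta> (Suc j) = shifted_fact \<phi>1 \<phi>2 1 \<beta> j * (\<phi>1 ^ j - \<beta> * \<phi>2 ^ j)"
    by (simp add: shifted_fact_def)
  moreover have "\<phi>1 ^ j - \<beta> * \<phi>2 ^ j = \<phi>1 ^ j * (1 - \<beta> * (\<phi>2 / \<phi>1) ^ j)"
    using \<phi>1 by (simp add: field_simps)
  ultimately show ?case
    using Suc.IH by (simp add: qpoch_Suc Suc_choose_two power_add)
qed

lemma deformed_trinomial_conv_gauss_coeff:
  assumes "\<bar>\<phi>2 / \<phi>1\<bar> < 1"
  shows "deformed_trinomial R p q (k + v + w) v w =
           \<phi>1 ^ (k * v + (k + v) * w) * (gauss_coeff (\<phi>2 / \<phi>1) (k + w) v * gauss_coeff (\<phi>2 / \<phi>1) k w)"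
proof -
  have "qfact (\<phi>2 / \<phi>1) (k + w) > 0"
    by (rule qfact_pos[OF assms])
  moreover have "(k + v + w) choose 2 = (k choose 2) + (v choose 2) + (w choose 2) + (k * v + (k + v) * w)"
    by (simp add: add_choose_two)
  ultimately show ?thesis
    using \<phi>1 by (simp add: deformed_trinomial_def deformed_fact_conv_qfact gauss_coeff_def
        power_add field_simps add_ac)
qed

lemma neg_trinomial2_mass_conv_qmass:
  assumes "\<bar>\<phi>2 / \<phi>1\<bar> < 1"
  shows "neg_trinomial2_mass R p q \<phi>1 \<phi>2 (Suc k) a b v w =
           \<phi>1 ^ tilt_exponent k v w * qmass (\<phi>2 / \<phi>1) k a b v w"
  using deformed_trinomial_conv_gauss_coeff[OF assms, of k v w]
  by (simp add: neg_trinomial2_mass_def qmass_def tilt_exponent_def shifted_fact_conv_qpoch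
      power_add mult_ac)

end

text \<open>Under \<open>M\<close> the variable \<open>c ^ -e\<close>, with \<open>e\<close> the exponent at \<open>(V1, V2)\<close>, has expectation equal to the
  total classical mass, which is \<open>1\<close>. As \<open>e \<ge> 0\<close>, the variable lies on one side of \<open>1\<close>, so it equals
  \<open>1\<close> almost surely. But \<open>(1, 1)\<close> has positive mass, and \<open>e > 0\<close> there.\<close>

lemma tilt_eq_1:
  assumes "prob_space M"
    and V1: "V1 \<in> measurable M (count_space UNIV)"
    and V2: "V2 \<in> measurable M (count_space UNIV)"
    and c: "c > 0" and q: "\<bar>q\<bar> < 1" and a: "0 < a" "a < 1" and b: "0 < b" "b < 1"
    and mass: "\<And>v w. measure M {\<omega> \<in> space M. V1 \<omega> = v \<and> V2 \<omega> = w} =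
                 c ^ tilt_exponent k v w * qmass q k a b v w"
  shows "c = 1"
proof (rule ccontr)
  assume "c \<noteq> 1"
  interpret prob_space M by fact
  note [measurable] = V1 V2
  define d where "d = inverse c"
  have d: "d > 0" "d \<noteq> 1" using c \<open>c \<noteq> 1\<close> by (auto simp: d_def)
  define G where "G \<omega> = d ^ tilt_exponent k (V1 \<omega>) (V2 \<omega>)" for \<omega>
  have cancel: "d ^ e * (c ^ e * x) = x" for e x
    using c by (simp add: d_def power_inverse)
  have "has_bochner_integral M (\<lambda>\<omega>. (\<lambda>v w. d ^ tilt_exponent k v w) (V1 \<omega>) (V2 \<omega>)) 1"
  proof (rule has_bochner_integral_nat_pair[OF assms(1) V1 V2,
        where F = "\<lambda>v w. d ^ tilt_exponent k v w"])
    show "0 \<le> d ^ tilt_exponent k v w" for v w using d by simp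
    show "(\<lambda>v. d ^ tilt_exponent k v w * measure M {\<omega> \<in> space M. V1 \<omega> = v \<and> V2 \<omega> = w}) sums
        (qpoch b q (Suc k) * (gauss_coeff q k w * b ^ w))" for w
      unfolding mass cancel by (rule qmass_total(1)[OF q a b])
    show "(\<lambda>w. qpoch b q (Suc k) * (gauss_coeff q k w * b ^ w)) sums 1"
      by (rule qmass_total(2)[OF q a b])
  qed
  hence G: "has_bochner_integral M G 1" by (simp add: G_def[abs_def])
  have AE: "AE \<omega> in M. G \<omega> = 1"
  proof (cases "d > 1")
    case True
    have "has_bochner_integral M (\<lambda>\<omega>. G \<omega> - 1) (1 - 1)"
      using G by (intro has_bochner_integral_diff) (simp_all add: has_bochner_integral_iff prob_space)
    moreover have "AE \<omega> in M. 0 \<le> G \<omega> - 1"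
      using True by (simp add: G_def)
    ultimately have "AE \<omega> in M. G \<omega> - 1 = 0"
      using integral_nonneg_eq_0_iff_AE[of M "\<lambda>\<omega>. G \<omega> - 1"] by (simp add: has_bochner_integral_iff)
    thus ?thesis by simp
  next
    case False
    have "has_bochner_integral M (\<lambda>\<omega>. 1 - G \<omega>) (1 - 1)"
      using G by (intro has_bochner_integral_diff) (simp_all add: has_bochner_integral_iff prob_space)
    moreover have "AE \<omega> in M. 0 \<le> 1 - G \<omega>"
      using False d by (simp add: G_def power_le_one)
    ultimately have "AE \<omega> in M. 1 - G \<omega> = 0"
      using integral_nonneg_eq_0_iff_AE[of M "\<lambda>\<omega>. 1 - G \<omega>"] by (simp add: has_bochner_integral_iff)
    thus ?thesis by simp
  qed
  have "tilt_exponent k 1 1 > 0" by (simp add: tilt_exponent_def)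
  hence ne: "d ^ tilt_exponent k 1 1 \<noteq> 1"
    using d power_eq_imp_eq_base[of d "tilt_exponent k 1 1" 1] by auto
  have "AE \<omega> in M. \<not> (V1 \<omega> = 1 \<and> V2 \<omega> = 1)"
    using AE by eventually_elim (use ne in \<open>auto simp: G_def\<close>)
  hence "measure M {\<omega> \<in> space M. V1 \<omega> = 1 \<and> V2 \<omega> = 1} = 0"
    by (subst (asm) AE_iff_measurable[OF _ refl]) (auto simp: measure_def)
  moreover have "c ^ tilt_exponent k 1 1 * qmass q k a b 1 1 > 0"
    using c qmass_pos[OF q a b, of k 1 1] by simp
  ultimately show False unfolding mass by linarith
qed

section \<open>Factorial moments of the negative trinomial distribution\<close>

theorem theorem2p15:
  fixes p q \<phi>1 \<phi>2 \<beta>1 \<beta>2 :: real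
    and R :: "complex \<times> complex \<Rightarrow> complex"
    and r :: "int \<Rightarrow> int \<Rightarrow> complex"
    and l n m1 m2 :: nat
    and M :: "'a measure"
    and V1 V2 :: "'a \<Rightarrow> nat"
  assumes "0 < q" "q < p" "p < 1"
    and "meromorphic2 R"
    and "has_laurent_series2 R l r"
    and "\<And>k. k \<ge> 1 \<Longrightarrow> holomorphic2_at R (of_real (p ^ k), of_real (q ^ k))"
    and "\<And>k. k \<ge> 1 \<Longrightarrow> R (of_real (p ^ k), of_real (q ^ k)) \<in> \<real>"
    and "\<And>k. k \<ge> 1 \<Longrightarrow> Re (R (of_real (p ^ k), of_real (q ^ k))) > 0"
    and "holomorphic2_at R (1, 1)"
    and "R (1, 1) = 0"
    and "\<phi>1 \<noteq> \<phi>2"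
    and "\<And>k. deformed_num R p q k = (\<phi>1 ^ k - \<phi>2 ^ k) / (\<phi>1 - \<phi>2)"
    and "n \<ge> 1"
    and "0 < \<beta>1" "\<beta>1 < 1" "0 < \<beta>2" "\<beta>2 < 1"
    and "prob_space M"
    and "V1 \<in> measurable M (count_space UNIV)"
    and "V2 \<in> measurable M (count_space UNIV)"
    and mass: "\<And>v1 v2. measure M {\<omega> \<in> space M. V1 \<omega> = v1 \<and> V2 \<omega> = v2} =
                 neg_trinomial2_mass R p q \<phi>1 \<phi>2 n \<beta>1 \<beta>2 v1 v2"
    \<comment> \<open>needed for the conditional expectations given \<open>V2 = v2\<close> to be defined for all \<open>v2\<close>\<close>
    and supp: "\<And>v2. measure M {\<omega> \<in> space M. V2 \<omega> = v2} > 0"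
  shows
    "has_bochner_integral M (\<lambda>\<omega>. deformed_ffact R p q (V2 \<omega>) m2)
       (\<beta>2 ^ m2 * deformed_ffact R p q (n + m2 - 1) m2 /
        shifted_fact \<phi>1 \<phi>2 (\<phi>1 ^ n) (\<beta>2 * \<phi>2 ^ n) m2) \<and>
     (\<forall>v2. has_bochner_integral (uniform_measure M {\<omega> \<in> space M. V2 \<omega> = v2})
       (\<lambda>\<omega>. deformed_ffact R p q (V1 \<omega>) m1)
       (\<beta>1 ^ m1 * deformed_ffact R p q (n + v2 + m1 - 1) m1 /
        shifted_fact \<phi>1 \<phi>2 (\<phi>1 ^ (n + v2)) (\<beta>1 * \<phi>2 ^ (n + v2)) m1)) \<and>
     has_bochner_integral M
       (\<lambda>\<omega>. shifted_fact \<phi>1 \<phi>2 (\<phi>1 ^ (n + V2 \<omega>)) (\<beta>1 * \<phi>2 ^ (n + V2 \<omega>)) m1 *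
            deformed_ffact R p q (V1 \<omega>) m1)
       (\<beta>1 ^ m1 * deformed_ffact R p q (n + m1 - 1) m1 /
        shifted_fact \<phi>1 \<phi>2 (\<phi>1 ^ n) (\<beta>2 * \<phi>2 ^ n) m1) \<and>
     has_bochner_integral M
       (\<lambda>\<omega>. shifted_fact \<phi>1 \<phi>2 (\<phi>1 ^ (n + V2 \<omega>)) (\<beta>1 * \<phi>2 ^ (n + V2 \<omega>)) m1 *
            deformed_ffact R p q (V1 \<omega>) m1 * deformed_ffact R p q (V2 \<omega>) m2)
       (\<beta>1 ^ m1 * \<beta>2 ^ m2 * deformed_ffact R p q (n + m1 + m2 - 1) (m1 + m2) /
        shifted_fact \<phi>1 \<phi>2 (\<phi>1 ^ n) (\<beta>2 * \<phi>2 ^ n) (m1 + m2))"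
proof -
  note ne = assms(11) and num = assms(12) and n = assms(13)
  note \<beta>1 = assms(14,15) and \<beta>2 = assms(16,17)
  note prob = assms(18) and V1 = assms(19) and V2 = assms(20)
  interpret prob_space M by (rule prob)
  obtain k where k: "n = Suc k" using n by (cases n) auto
  have num_pos: "deformed_num R p q j > 0" if "j \<ge> 1" for j
    using assms(8)[OF that] by (simp add: deformed_num_def)
  have fact_pos: "deformed_fact R p q j > 0" for j
    unfolding deformed_fact_def by (intro prod_pos) (auto intro: num_pos)
  have tri_pos: "deformed_trinomial R p q N v w > 0" for N v w
    by (simp add: deformed_trinomial_def fact_pos)
  \<comment> \<open>\<open>c (n + w) * D\<close> is the only part of the mass at \<open>(v, w)\<close> whose sign is not evident, and it does not
    depend on \<open>v\<close>; if it were not positive, the event \<open>V2 = w\<close> would be a null set.\<close>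
  define D where "D = shifted_fact \<phi>1 \<phi>2 1 \<beta>2 n"
  define c where "c j = shifted_fact \<phi>1 \<phi>2 1 \<beta>1 j" for j
  have cD_pos: "c (n + w) * D > 0" for w
  proof (rule ccontr)
    assume "\<not> c (n + w) * D > 0"
    hence le: "c (n + w) * D \<le> 0" by simp
    have "measure M {\<omega> \<in> space M. V1 \<omega> = v \<and> V2 \<omega> = w} = 0" for v
    proof -
      have "deformed_trinomial R p q (n + v + w - 1) v w * \<beta>1 ^ v * \<beta>2 ^ w * (c (n + w) * D) \<le> 0"
        using \<beta>1(1) \<beta>2(1) tri_pos[of "n + v + w - 1" v w]
        by (intro mult_nonneg_nonpos[OF _ le]) simp
      hence "measure M {\<omega> \<in> space M. V1 \<omega> = v \<and> V2 \<omega> = w} \<le> 0"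
        by (simp add: mass neg_trinomial2_mass_def c_def D_def mult.assoc)
      thus ?thesis by (simp add: measure_le_0_iff)
    qed
    with sums_measure_level_sets[OF prob V1 V2, of w] supp[of w] show False
      by (simp add: sums_iff)
  qed
  \<comment> \<open>Passing from \<open>w\<close> to \<open>Suc w\<close> multiplies this part by exactly one factor, which must be positive.\<close>
  have "\<beta>1 * \<phi>2 ^ j < \<phi>1 ^ j" if "j \<ge> n" for j
  proof -
    obtain w where w: "j = n + w" using \<open>j \<ge> n\<close> le_Suc_ex by blast
    have "c (n + Suc w) = c (n + w) * (\<phi>1 ^ j - \<beta>1 * \<phi>2 ^ j)"
      by (simp add: c_def shifted_fact_def w)
    hence "0 < (c (n + w) * D) * (\<phi>1 ^ j - \<beta>1 * \<phi>2 ^ j)"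
      using cD_pos[of "Suc w"] by (simp add: mult_ac)
    hence "0 < \<phi>1 ^ j - \<beta>1 * \<phi>2 ^ j"
      using cD_pos[of w] zero_less_mult_pos by blast
    thus ?thesis by simp
  qed
  moreover have "\<phi>1 + \<phi>2 > 0"
  proof -
    have "deformed_num R p q 2 = \<phi>1 + \<phi>2"
      using ne by (simp add: num power2_eq_square field_simps)
    thus ?thesis using num_pos[of 2] by simp
  qed
  ultimately have dom: "\<bar>\<phi>2\<bar> < \<phi>1"
    using ne \<beta>1(1) by (intro dominant_root[of \<phi>1 \<phi>2 \<beta>1 n])
  hence \<phi>1_pos: "\<phi>1 > 0" by linarith
  hence ratio: "\<bar>\<phi>2 / \<phi>1\<bar> < 1" using dom by (simp add: abs_div)
  have "\<phi>1 = 1"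
  proof (rule tilt_eq_1[OF prob V1 V2 \<phi>1_pos ratio \<beta>1 \<beta>2])
    show "measure M {\<omega> \<in> space M. V1 \<omega> = v \<and> V2 \<omega> = w} =
        \<phi>1 ^ tilt_exponent k v w * qmass (\<phi>2 / \<phi>1) k \<beta>1 \<beta>2 v w" for v w
      using neg_trinomial2_mass_conv_qmass[OF num _ ne ratio] \<phi>1_pos by (simp add: mass k)
  qed
  have q: "\<bar>\<phi>2\<bar> < 1" using dom \<open>\<phi>1 = 1\<close> by simp
  have pmf: "measure M {\<omega> \<in> space M. V1 \<omega> = v \<and> V2 \<omega> = w} = qmass \<phi>2 k \<beta>1 \<beta>2 v w" for v w
    using neg_trinomial2_mass_conv_qmass[OF num _ ne ratio] by (simp add: mass k \<open>\<phi>1 = 1\<close>)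
  have "deformed_num R p q j = qnum \<phi>2 j" for j
    by (simp add: num qnum_def \<open>\<phi>1 = 1\<close>)
  hence ff: "deformed_ffact R p q u r = qffact \<phi>2 u r" for u r
    by (simp add: deformed_ffact_def qffact_def)
  have sf: "shifted_fact \<phi>1 \<phi>2 (\<phi>1 ^ i) (\<beta> * \<phi>2 ^ i) m = qpoch (\<beta> * \<phi>2 ^ i) \<phi>2 m" for \<beta> i m
  proof -
    have "(\<Prod>i=1..m. 1 - x * \<phi>2 ^ (i - 1)) = (\<Prod>i<m. 1 - x * \<phi>2 ^ i)" for x
      by (induction m) simp_all
    thus ?thesis by (simp add: shifted_fact_def qpoch_def \<open>\<phi>1 = 1\<close>)
  qed
  have joint: "has_bochner_integral M
      (\<lambda>\<omega>. qpoch (\<beta>1 * \<phi>2 ^ (n + V2 \<omega>)) \<phi>2 m1 * qffact \<phi>2 (V1 \<omega>) m1 * qffact \<phi>2 (V2 \<omega>) m2)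
      (\<beta>1 ^ m1 * \<beta>2 ^ m2 * qffact \<phi>2 (n + m1 + m2 - 1) (m1 + m2) / qpoch (\<beta>2 * \<phi>2 ^ n) \<phi>2 (m1 + m2))"
    for m1 m2
  proof (rule has_bochner_integral_nat_pair[OF prob V1 V2])
    show "0 \<le> qpoch (\<beta>1 * \<phi>2 ^ (n + w)) \<phi>2 m1 * qffact \<phi>2 v m1 * qffact \<phi>2 w m2" for v w
      using qpoch_pos(2)[OF q \<beta>1] q by (simp add: qffact_nonneg less_imp_le)
    show "(\<lambda>v. qpoch (\<beta>1 * \<phi>2 ^ (n + w)) \<phi>2 m1 * qffact \<phi>2 v m1 * qffact \<phi>2 w m2 *
          measure M {\<omega> \<in> space M. V1 \<omega> = v \<and> V2 \<omega> = w}) sums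
        (\<beta>1 ^ m1 * (qffact \<phi>2 w m2 * (qffact \<phi>2 (k + w + m1) m1 *
          (qpoch \<beta>2 \<phi>2 (Suc k) * (gauss_coeff \<phi>2 k w * \<beta>2 ^ w)))))" for w
    proof -
      define P where "P = qpoch (\<beta>1 * \<phi>2 ^ (n + w)) \<phi>2 m1"
      have P: "P > 0" unfolding P_def by (rule qpoch_pos(2)[OF q \<beta>1])
      have "(\<lambda>v. (P * qffact \<phi>2 w m2) * (qffact \<phi>2 v m1 * qmass \<phi>2 k \<beta>1 \<beta>2 v w)) sums
          ((P * qffact \<phi>2 w m2) * (\<beta>1 ^ m1 * qffact \<phi>2 (k + w + m1) m1 / P *
            (qpoch \<beta>2 \<phi>2 (Suc k) * (gauss_coeff \<phi>2 k w * \<beta>2 ^ w))))"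
        using qmass_inner_sum[OF q \<beta>1, of m1 k \<beta>2 w] by (intro sums_mult) (simp add: P_def k)
      thus ?thesis using P by (simp add: pmf mult_ac flip: P_def)
    qed
    show "(\<lambda>w. \<beta>1 ^ m1 * (qffact \<phi>2 w m2 * (qffact \<phi>2 (k + w + m1) m1 *
          (qpoch \<beta>2 \<phi>2 (Suc k) * (gauss_coeff \<phi>2 k w * \<beta>2 ^ w))))) sums
        (\<beta>1 ^ m1 * \<beta>2 ^ m2 * qffact \<phi>2 (n + m1 + m2 - 1) (m1 + m2) / qpoch (\<beta>2 * \<phi>2 ^ n) \<phi>2 (m1 + m2))"
      using sums_mult[OF qmass_outer_sum[OF q \<beta>2, of m2 k m1], of "\<beta>1 ^ m1"]
      by (simp add: k mult.assoc)
  qed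
  have conditional: "has_bochner_integral (uniform_measure M {\<omega> \<in> space M. V2 \<omega> = w})
      (\<lambda>\<omega>. qffact \<phi>2 (V1 \<omega>) m1)
      (\<beta>1 ^ m1 * qffact \<phi>2 (n + w + m1 - 1) m1 / qpoch (\<beta>1 * \<phi>2 ^ (n + w)) \<phi>2 m1)" for w
  proof (rule conditional_moment_of_mass[OF prob V1 V2 _ supp])
    have "measure M {\<omega> \<in> space M. V2 \<omega> = w} = qpoch \<beta>2 \<phi>2 (Suc k) * (gauss_coeff \<phi>2 k w * \<beta>2 ^ w)"
      using sums_measure_level_sets[OF prob V1 V2, of w] qmass_total(1)[OF q \<beta>1 \<beta>2, of k w]
      by (simp add: pmf sums_iff)
    thus "(\<lambda>v. qffact \<phi>2 v m1 * measure M {\<omega> \<in> space M. V1 \<omega> = v \<and> V2 \<omega> = w}) sums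
        (\<beta>1 ^ m1 * qffact \<phi>2 (n + w + m1 - 1) m1 / qpoch (\<beta>1 * \<phi>2 ^ (n + w)) \<phi>2 m1 *
         measure M {\<omega> \<in> space M. V2 \<omega> = w})"
      using qmass_inner_sum[OF q \<beta>1, of m1 k \<beta>2 w] by (simp add: pmf k)
  qed (simp add: qffact_nonneg q)
  show ?thesis
    using joint[of 0 m2] conditional joint[of m1 0] joint[of m1 m2]
    by (simp add: ff sf)
qed

end
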